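(* Let $\phi:\mathbb R\to[0,+\infty)$ be a finite-valued Orlicz function with $ces_\phi\neq\{0\}$. The space $A_\phi$ (with the norm $\|\cdot\|_\phi$) is strictly monotone if and only if $\phi>0$, i.e. $\phi$ takes the value zero only at zero.
   Context: A finite-valued map $\phi:\mathbb R\to[0,+\infty)$ is an Orlicz function if it is even, convex, $\phi(0)=0$ and $\phi(u)\to\infty$ as $u\to\infty$ (it is then automatically continuous). Let $l^0$ be the space of all real sequences $x=(x(i))_{i=1}^\infty$. For $x\in l^0$ put $\sigma x(i)=\frac1i\sum_{j=1}^i|x(j)|$ and $\rho_\phi(x)=\sum_{i=1}^\infty\phi(\sigma x(i))$. The Cesàro–Orlicz sequence space is $ces_\phi=\{x\in l^0:\ \rho_\phi(\lambda x)<\infty\text{ for some }\lambda>0\}$, equipped with the Luxemburg norm $\|x\|_\phi=\inf\{\lambda>0:\rho_\phi(x/\lambda)\le1\}$. Its subspace $A_\phi$ is $$A_\phi=\Big\{x\in ces_\phi:\ \forall k>0\ \exists n_k\in\mathbb N\ \ \sum_{n=n_k}^\infty\phi\Big(\frac kn\sum_{i=1}^n|x(i)|\Big)<\infty\Big\}.$$ A normed sequence space $X\subset l^0$ is strictly monotone if $\|x\|<\|y\|$ for all $x,y\in X$ such that $0\le x\le y$ (coordinatewise) and $x\neq y$. *)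

theory Defs
  imports "HOL-Analysis.Analysis"
begin

definition orlicz_function :: "(real \<Rightarrow> real) \<Rightarrow> bool" where
  "orlicz_function \<phi> \<longleftrightarrow>
     (\<forall>u. 0 \<le> \<phi> u) \<and> (\<forall>u. \<phi> (- u) = \<phi> u) \<and> convex_on UNIV \<phi> \<and>
     \<phi> 0 = 0 \<and> filterlim \<phi> at_top at_top"

text \<open>
  A real sequence \<open>(x(1), x(2), \<dots>)\<close> is encoded as a function \<open>x :: nat \<Rightarrow> real\<close> shifted by one:
  \<open>x i\<close> is the mathematical coordinate \<open>x(i + 1)\<close>, and \<open>cesaro_mean x i\<close> is \<open>\<sigma>x(i + 1)\<close>.
\<close>

definition cesaro_mean :: "(nat \<Rightarrow> real) \<Rightarrow> nat \<Rightarrow> real" where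
  "cesaro_mean x i = 1 / real (Suc i) * (\<Sum>j\<le>i. \<bar>x j\<bar>)"

definition ces_modular :: "(real \<Rightarrow> real) \<Rightarrow> (nat \<Rightarrow> real) \<Rightarrow> ennreal" where
  "ces_modular \<phi> x = (\<Sum>i. ennreal (\<phi> (cesaro_mean x i)))"

definition ces_space :: "(real \<Rightarrow> real) \<Rightarrow> (nat \<Rightarrow> real) set" where
  "ces_space \<phi> = {x. \<exists>c>0. ces_modular \<phi> (\<lambda>i. c * x i) < \<infinity>}"

definition ces_norm :: "(real \<Rightarrow> real) \<Rightarrow> (nat \<Rightarrow> real) \<Rightarrow> real" where
  "ces_norm \<phi> x = Inf {c. 0 < c \<and> ces_modular \<phi> (\<lambda>i. x i / c) \<le> 1}"

text \<open>Since \<open>k\<close> times \<open>\<sigma>x(n)\<close> is \<open>(k / n) (\<bar>x(1)\<bar> + \<dots> + \<bar>x(n)\<bar>)\<close>, the series below is the tail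
  of the defining series that starts at the mathematical index \<open>m + 1\<close>.\<close>

definition ces_A :: "(real \<Rightarrow> real) \<Rightarrow> (nat \<Rightarrow> real) set" where
  "ces_A \<phi> = {x \<in> ces_space \<phi>.
     \<forall>k>0. \<exists>m. (\<Sum>n. ennreal (\<phi> (k * cesaro_mean x (m + n)))) < \<infinity>}"

definition strictly_monotone_space ::
  "(nat \<Rightarrow> real) set \<Rightarrow> ((nat \<Rightarrow> real) \<Rightarrow> real) \<Rightarrow> bool" where
  "strictly_monotone_space X N \<longleftrightarrow>
     (\<forall>x\<in>X. \<forall>y\<in>X. (\<forall>i. 0 \<le> x i \<and> x i \<le> y i) \<and> x \<noteq> y \<longrightarrow> N x < N y)"

end

theory Submission
  imports Defs
begin

text \<open>
  Finiteness of \<open>\<phi>\<close> makes \<open>\<rho>(k y)\<close> finite for every \<open>y \<in> A\<^sub>\<phi>\<close> and every \<open>k > 0\<close>.  If \<open>\<phi>\<close> vanishes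
  only at zero, it is strictly increasing on the half line, so for \<open>0 \<le> x \<le> y\<close>, \<open>x \<noteq> y\<close> and
  \<open>N = \<parallel>y\<parallel>\<close> we get \<open>\<rho>(x / N) < \<rho>(y / N) \<le> 1\<close>; by convexity of \<open>t \<mapsto> \<rho>(t x / N)\<close> the modular stays
  below \<open>1\<close> for some \<open>t > 1\<close>, whence \<open>\<parallel>x\<parallel> \<le> N / t < N\<close>.  If instead \<open>\<phi>\<close> vanishes on \<open>[0, u]\<close> with
  \<open>u > 0\<close>, then adding to the first unit vector another unit vector of sufficiently large index
  changes the Cesaro means only where \<open>\<phi>\<close> vanishes, and hence does not change the norm.
\<close>

section \<open>Cesaro means\<close>

lemma cesaro_mean_scale: "cesaro_mean (\<lambda>i. c * x i) n = \<bar>c\<bar> * cesaro_mean x n"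
  by (simp add: cesaro_mean_def abs_mult sum_distrib_left algebra_simps)

lemma cesaro_mean_divide: "c > 0 \<Longrightarrow> cesaro_mean (\<lambda>i. x i / c) n = 1 / c * cesaro_mean x n"
  using cesaro_mean_scale[of "1 / c" x n] by simp

lemma cesaro_mean_nonneg: "0 \<le> cesaro_mean x n"
  by (simp add: cesaro_mean_def sum_nonneg)

lemma cesaro_mean_mono:
  assumes "\<And>i. 0 \<le> x i" "\<And>i. x i \<le> y i"
  shows "cesaro_mean x n \<le> cesaro_mean y n"
proof -
  have "0 \<le> y i" for i using assms order_trans by blast
  then have "(\<Sum>j\<le>n. \<bar>x j\<bar>) \<le> (\<Sum>j\<le>n. \<bar>y j\<bar>)"
    using assms by (intro sum_mono) simp
  then show ?thesis
    unfolding cesaro_mean_def by (intro mult_left_mono) simp_all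
qed

lemma cesaro_mean_strict_mono:
  assumes "\<And>i. 0 \<le> x i" "\<And>i. x i \<le> y i" "x m < y m"
  shows "cesaro_mean x m < cesaro_mean y m"
proof -
  have "0 \<le> y i" for i using assms order_trans by blast
  then have "(\<Sum>j\<le>m. \<bar>x j\<bar>) < (\<Sum>j\<le>m. \<bar>y j\<bar>)"
    using assms by (intro sum_strict_mono_ex1) auto
  then show ?thesis
    unfolding cesaro_mean_def by (intro mult_strict_left_mono) simp_all
qed

section \<open>Orlicz functions on the half line\<close>

lemma orlicz_nonneg: "orlicz_function \<phi> \<Longrightarrow> 0 \<le> \<phi> u"
  by (simp add: orlicz_function_def)

lemma orlicz_scale:
  assumes "orlicz_function \<phi>" "0 \<le> s" "s \<le> 1"
  shows "\<phi> (s * u) \<le> s * \<phi> u"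
proof -
  have "convex_on UNIV \<phi>" "\<phi> 0 = 0" using assms by (auto simp: orlicz_function_def)
  then show ?thesis
    using convex_onD[of UNIV \<phi> s 0 u] assms by simp
qed

lemma orlicz_mono:
  assumes "orlicz_function \<phi>" "0 \<le> u" "u \<le> v"
  shows "\<phi> u \<le> \<phi> v"
proof (cases "v = 0")
  case False
  then have "\<phi> (u / v * v) \<le> u / v * \<phi> v" "u / v * \<phi> v \<le> 1 * \<phi> v"
    using assms orlicz_nonneg[OF assms(1)]
    by (intro orlicz_scale mult_right_mono; simp)+
  then show ?thesis using False by simp
qed (use assms in auto)

text \<open>Scaling by \<open>u / v < 1\<close> strictly lowers the positive value
  \<open>\<phi> v\<close>. Only the larger argument has to avoid the zero set, so
  \<open>\<phi> u\<close> may still vanish.\<close>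

lemma orlicz_strict_mono:
  assumes "orlicz_function \<phi>" "0 \<le> u" "u < v" "\<phi> v \<noteq> 0"
  shows "\<phi> u < \<phi> v"
proof -
  have "\<phi> v > 0" using orlicz_nonneg[OF assms(1), of v] assms(4) by simp
  then have "u / v * \<phi> v < 1 * \<phi> v"
    using assms by (intro mult_strict_right_mono) simp_all
  moreover have "\<phi> (u / v * v) \<le> u / v * \<phi> v"
    using assms by (intro orlicz_scale) simp_all
  ultimately show ?thesis using assms by simp
qed

lemma orlicz_isCont: "orlicz_function \<phi> \<Longrightarrow> isCont \<phi> u"
  using convex_on_continuous[of UNIV \<phi>]
  by (simp add: orlicz_function_def continuous_on_eq_continuous_at)

text \<open>The threshold \<open>K\<close> bounds the scalars admissible in the Luxemburg infimum
  from below: one term of the modular above 1 already excludes a scalar.\<close>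

lemma orlicz_gt_one:
  assumes "orlicz_function \<phi>"
  obtains K where "K > 0" "\<And>u. K \<le> u \<Longrightarrow> 1 < \<phi> u"
proof -
  have "eventually (\<lambda>u. 1 < \<phi> u) at_top"
    using assms by (simp add: orlicz_function_def filterlim_at_top_dense)
  then obtain K where "\<And>u. K \<le> u \<Longrightarrow> 1 < \<phi> u"
    by (auto simp: eventually_at_top_linorder)
  then show ?thesis using that[of "max K 1"] by simp
qed

section \<open>The modular and the Luxemburg infimum\<close>

lemma ces_modular_le_one_iff:
  assumes "orlicz_function \<phi>" "c > 0" "summable (\<lambda>n. \<phi> (1 / c * cesaro_mean x n))"
  shows "ces_modular \<phi> (\<lambda>i. x i / c) \<le> 1 \<longleftrightarrow> (\<Sum>n. \<phi> (1 / c * cesaro_mean x n)) \<le> 1"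
proof -
  have "ces_modular \<phi> (\<lambda>i. x i / c) = ennreal (\<Sum>n. \<phi> (1 / c * cesaro_mean x n))"
    unfolding ces_modular_def cesaro_mean_divide[OF assms(2)]
    using assms orlicz_nonneg by (intro suminf_ennreal2) auto
  then show ?thesis
    using assms by (simp add: ennreal_le_1)
qed

lemma ces_norm_le:
  assumes "c > 0" "ces_modular \<phi> (\<lambda>i. x i / c) \<le> 1"
  shows "ces_norm \<phi> x \<le> c"
  unfolding ces_norm_def using assms by (intro cInf_lower bdd_belowI[of _ 0]) auto

text \<open>The terms before the convergent tail are finitely many real numbers, because \<phi> is
  finite-valued. Hence every dilation has a finite modular, and real series can replace extended
  ones.\<close>

lemma ces_A_summable:
  assumes "orlicz_function \<phi>" "x \<in> ces_A \<phi>" "k > 0"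
  shows "summable (\<lambda>n. \<phi> (k * cesaro_mean x n))"
proof -
  obtain m where "(\<Sum>n. ennreal (\<phi> (k * cesaro_mean x (m + n)))) < \<infinity>"
    using assms by (auto simp: ces_A_def)
  then have "summable (\<lambda>n. \<phi> (k * cesaro_mean x (m + n)))"
    using orlicz_nonneg[OF assms(1)] by (intro summable_suminf_not_top) auto
  then show ?thesis
    using summable_iff_shift[of "\<lambda>n. \<phi> (k * cesaro_mean x n)" m] by (simp add: add.commute)
qed

text \<open>One positive mean keeps admissible scalars away from zero. The infimum is itself
  admissible, by continuity of \<phi> applied to partial sums.\<close>

lemma ces_norm_positive:
  assumes phi: "orlicz_function \<phi>" and y: "y \<in> ces_A \<phi>" and m: "cesaro_mean y m > 0"
  shows "ces_norm \<phi> y > 0"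
    and "(\<Sum>n. \<phi> (1 / ces_norm \<phi> y * cesaro_mean y n)) \<le> 1"
proof -
  define S where "S = {c. 0 < c \<and> ces_modular \<phi> (\<lambda>i. y i / c) \<le> 1}"
  define R where "R t = (\<Sum>n. \<phi> (t * cesaro_mean y n))" for t
  have summ: "summable (\<lambda>n. \<phi> (t * cesaro_mean y n))" if "t > 0" for t
    using ces_A_summable[OF phi y that] .
  have S_iff: "c \<in> S \<longleftrightarrow> 0 < c \<and> R (1 / c) \<le> 1" for c
    using ces_modular_le_one_iff[OF phi _ summ] by (auto simp: S_def R_def)
  have N: "ces_norm \<phi> y = Inf S" by (simp add: ces_norm_def S_def)
  \<comment> \<open>Convexity gives \<open>R s \<le> s * R 1 \<le> 1\<close>, so
    \<open>1 / s\<close> is admissible and the infimum is over a nonempty set.\<close>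
  define s where "s = 1 / (1 + R 1)"
  have R1: "R 1 \<ge> 0"
    unfolding R_def using summ[of 1] orlicz_nonneg[OF phi] by (intro suminf_nonneg) auto
  then have s: "0 < s" "s \<le> 1" by (auto simp: s_def)
  have "R s \<le> (\<Sum>n. s * \<phi> (1 * cesaro_mean y n))"
    unfolding R_def using orlicz_scale[OF phi] s summ[of 1] summ[of s]
    by (intro suminf_le summable_mult) auto
  also have "\<dots> = s * R 1" unfolding R_def using summ[of 1] by (intro suminf_mult) simp
  also have "\<dots> \<le> 1" using R1 by (simp add: s_def field_simps)
  finally have ne: "S \<noteq> {}" using S_iff[of "1 / s"] s by auto
  obtain K where K: "K > 0" "\<And>u. K \<le> u \<Longrightarrow> 1 < \<phi> u" using orlicz_gt_one[OF phi] by blast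
  have low: "cesaro_mean y m / K \<le> c" if "c \<in> S" for c
  proof (rule ccontr)
    assume "\<not> ?thesis"
    then have "K \<le> 1 / c * cesaro_mean y m" using K that S_iff[of c] by (simp add: field_simps)
    then have "1 < (\<Sum>n\<in>{m}. \<phi> (1 / c * cesaro_mean y n))" using K by simp
    also have "\<dots> \<le> R (1 / c)"
      unfolding R_def using that S_iff[of c] orlicz_nonneg[OF phi] summ[of "1 / c"]
      by (intro sum_le_suminf) auto
    finally show False using that S_iff[of c] by simp
  qed
  have "cesaro_mean y m / K \<le> Inf S" using ne low by (intro cInf_greatest)
  moreover have "cesaro_mean y m / K > 0" using m K by simp
  ultimately show pos: "ces_norm \<phi> y > 0" using N by linarith
  \<comment> \<open>The limit as \<open>c\<close> decreases to \<open>Inf S\<close> is taken in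
    finite sums only, where continuity is immediate; the full series follows by letting
    \<open>k\<close> grow.\<close>
  have part: "(\<Sum>n<k. \<phi> (1 / Inf S * cesaro_mean y n)) \<le> 1" for k
  proof (rule tendsto_upperbound)
    let ?f = "\<lambda>c. \<Sum>n<k. \<phi> (1 / c * cesaro_mean y n)"
    have "isCont (\<lambda>c. 1 / c * cesaro_mean y n) (Inf S)" for n
      using pos N by (intro continuous_intros) simp
    then have "isCont (\<lambda>c. \<phi> (1 / c * cesaro_mean y n)) (Inf S)" for n
      by (rule isCont_o2) (rule orlicz_isCont[OF phi])
    then have "isCont ?f (Inf S)" by (intro isCont_sum) simp
    then show "(?f \<longlongrightarrow> ?f (Inf S)) (at_right (Inf S))"
      by (simp add: isCont_def filterlim_at_split)
    have "?f c \<le> 1" if c: "Inf S < c" for c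
    proof -
      \<comment> \<open>Some admissible \<open>d\<close> lies below \<open>c\<close>, and the
        partial sums decrease as the scalar grows.\<close>
      obtain d where d: "d \<in> S" "d < c" using cInf_lessD[OF ne c] by blast
      then have "0 < d" using S_iff by blast
      then have "?f c \<le> ?f d"
        using d cesaro_mean_nonneg[of y]
        by (intro sum_mono orlicz_mono[OF phi] mult_right_mono) (auto simp: frac_le)
      also have "\<dots> \<le> R (1 / d)"
        unfolding R_def using \<open>0 < d\<close> orlicz_nonneg[OF phi] summ[of "1 / d"]
        by (intro sum_le_suminf) auto
      also have "\<dots> \<le> 1" using d S_iff by blast
      finally show ?thesis .
    qed
    then show "\<forall>\<^sub>F c in at_right (Inf S). ?f c \<le> 1"
      by (auto simp: eventually_at_filter)
  qed simp
  show "(\<Sum>n. \<phi> (1 / ces_norm \<phi> y * cesaro_mean y n)) \<le> 1"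
    unfolding N using part pos N by (intro suminf_le_const summ) auto
qed

section \<open>Strict monotonicity when \<phi> vanishes only at zero\<close>

lemma ces_A_strictly_monotone:
  assumes phi: "orlicz_function \<phi>" and pos: "\<And>u. \<phi> u = 0 \<Longrightarrow> u = 0"
  shows "strictly_monotone_space (ces_A \<phi>) (ces_norm \<phi>)"
  unfolding strictly_monotone_space_def
proof (intro ballI impI)
  fix x y assume x: "x \<in> ces_A \<phi>" and y: "y \<in> ces_A \<phi>"
    and "(\<forall>i. 0 \<le> x i \<and> x i \<le> y i) \<and> x \<noteq> y"
  then have xy: "\<And>i. 0 \<le> x i" "\<And>i. x i \<le> y i" and "x \<noteq> y" by auto
  then obtain m where "x m \<noteq> y m" by blast
  with xy have "x m < y m" by (simp add: order_less_le)
  with xy have lt: "cesaro_mean x m < cesaro_mean y m" by (intro cesaro_mean_strict_mono)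
  define N where "N = ces_norm \<phi> y"
  define R where "R t = (\<Sum>n. \<phi> (t * cesaro_mean x n))" for t
  have ym: "cesaro_mean y m > 0" using lt cesaro_mean_nonneg[of x m] by linarith
  have N: "N > 0" "(\<Sum>n. \<phi> (1 / N * cesaro_mean y n)) \<le> 1"
    using ces_norm_positive[OF phi y ym] by (auto simp: N_def)
  have summ: "summable (\<lambda>n. \<phi> (t * cesaro_mean x n))" if "t > 0" for t
    using ces_A_summable[OF phi x that] .
  have summy: "summable (\<lambda>n. \<phi> (1 / N * cesaro_mean y n))"
    using ces_A_summable[OF phi y, of "1 / N"] N by simp
  have diff: "summable (\<lambda>n. \<phi> (1 / N * cesaro_mean y n) - \<phi> (1 / N * cesaro_mean x n))"
    using summ[of "1 / N"] summy N by (intro summable_diff) auto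
  have "\<phi> (1 / N * cesaro_mean x n) \<le> \<phi> (1 / N * cesaro_mean y n)" for n
    using N cesaro_mean_mono[of x y, OF xy] cesaro_mean_nonneg[of x]
    by (intro orlicz_mono[OF phi] mult_left_mono) auto
  moreover have "\<phi> (1 / N * cesaro_mean x m) < \<phi> (1 / N * cesaro_mean y m)"
  proof (rule orlicz_strict_mono[OF phi])
    show "\<phi> (1 / N * cesaro_mean y m) \<noteq> 0" using pos[of "1 / N * cesaro_mean y m"] N ym by auto
    show "1 / N * cesaro_mean x m < 1 / N * cesaro_mean y m"
      using N lt by (intro mult_strict_left_mono) auto
  qed (use N cesaro_mean_nonneg[of x m] in auto)
  \<comment> \<open>The termwise differences are nonnegative and the one at \<open>m\<close> is
    positive, so the gap survives summation.\<close>
  ultimately have "0 < (\<Sum>n. \<phi> (1 / N * cesaro_mean y n) - \<phi> (1 / N * cesaro_mean x n))"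
    by (intro suminf_pos2[OF diff, of m]) auto
  then have R1: "R (1 / N) < 1"
    using suminf_diff[OF summy summ[of "1 / N"]] N by (simp add: R_def)
  have R2: "R (2 / N) \<ge> 0"
    unfolding R_def using summ[of "2 / N"] N orlicz_nonneg[OF phi] by (intro suminf_nonneg) auto
  have R0: "R (1 / N) \<ge> 0"
    unfolding R_def using summ[of "1 / N"] N orlicz_nonneg[OF phi] by (intro suminf_nonneg) auto
  \<comment> \<open>This \<open>s\<close> solves \<open>R (1 / N) + s * (1 + R (2 / N)) = 1\<close>.
    The series \<open>R (2 / N)\<close> converges because \<open>x\<close> lies in
    \<open>ces_A \<phi>\<close>; the added 1 keeps the denominator positive.\<close>
  define s where "s = (1 - R (1 / N)) / (1 + R (2 / N))"
  have s: "0 < s" "s \<le> 1" using R0 R1 R2 by (auto simp: s_def field_simps)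
  have "R ((1 + s) / N) \<le> (\<Sum>n. (1 - s) * \<phi> (1 / N * cesaro_mean x n) + s * \<phi> (2 / N * cesaro_mean x n))"
    unfolding R_def
  proof (rule suminf_le)
    fix n
    have cv: "convex_on UNIV \<phi>" using phi by (simp add: orlicz_function_def)
    \<comment> \<open>The dilation \<open>(1 + s) / N\<close> is the convex combination of
      \<open>1 / N\<close> and \<open>2 / N\<close> with weights \<open>1 - s\<close> and
      \<open>s\<close>.\<close>
    have "(1 + s) / N * cesaro_mean x n
      = (1 - s) * (1 / N * cesaro_mean x n) + s * (2 / N * cesaro_mean x n)"
      using N by (simp add: field_simps)
    then show "\<phi> ((1 + s) / N * cesaro_mean x n)
      \<le> (1 - s) * \<phi> (1 / N * cesaro_mean x n) + s * \<phi> (2 / N * cesaro_mean x n)"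
      using convex_onD[OF cv, of s "1 / N * cesaro_mean x n" "2 / N * cesaro_mean x n"] s by simp
  qed (use s N in \<open>intro summ summable_add summable_mult; simp\<close>)+
  also have "\<dots> = (1 - s) * R (1 / N) + s * R (2 / N)"
    unfolding R_def using summ[of "1 / N"] summ[of "2 / N"] N
    by (subst suminf_add[symmetric]) (auto simp: suminf_mult intro!: summable_mult)
  also have "\<dots> \<le> R (1 / N) + s * (1 + R (2 / N))"
    using s R0 by (simp add: algebra_simps add_increasing)
  also have "\<dots> = 1" using R2 by (simp add: s_def)
  finally have le: "R (1 / (N / (1 + s))) \<le> 1" by simp
  have c: "N / (1 + s) > 0" using N s by simp
  then have "ces_modular \<phi> (\<lambda>i. x i / (N / (1 + s))) \<le> 1"
    using ces_modular_le_one_iff[OF phi c summ] le c unfolding R_def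
    by (metis zero_less_divide_1_iff)
  then have "ces_norm \<phi> x \<le> N / (1 + s)" using ces_norm_le[OF c] by blast
  also have "\<dots> < N" using N s by (simp add: field_simps)
  finally show "ces_norm \<phi> x < ces_norm \<phi> y" by (simp add: N_def)
qed

section \<open>Failure when \<phi> has a nonzero zero\<close>

lemma ces_A_memI:
  assumes phi: "orlicz_function \<phi>" and u: "u > 0" "\<phi> u = 0"
    and lim: "cesaro_mean x \<longlonglongrightarrow> 0"
  shows "x \<in> ces_A \<phi>"
proof -
  \<comment> \<open>The means eventually drop below \<open>u / k\<close>, so the scaled tail lies in
    the interval from 0 to \<open>u\<close>, where \<phi> vanishes. Each defining series then has
    only finitely many nonzero terms.\<close>
  have zero: "\<exists>m. \<forall>n\<ge>m. \<phi> (k * cesaro_mean x n) = 0" if "k > 0" for k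
  proof -
    have "eventually (\<lambda>n. cesaro_mean x n < u / k) sequentially"
      using lim that u by (intro order_tendstoD(2)) auto
    then obtain m where m: "\<And>n. n \<ge> m \<Longrightarrow> cesaro_mean x n < u / k"
      by (auto simp: eventually_sequentially)
    have "\<phi> (k * cesaro_mean x n) = 0" if "n \<ge> m" for n
    proof -
      have "\<phi> (k * cesaro_mean x n) \<le> \<phi> u"
        using m[OF that] \<open>k > 0\<close> cesaro_mean_nonneg[of x n]
        by (intro orlicz_mono[OF phi]) (auto simp: field_simps)
      then show ?thesis using u orlicz_nonneg[OF phi] by (simp add: order_antisym)
    qed
    then show ?thesis by blast
  qed
  obtain m where m: "\<And>n. n \<ge> m \<Longrightarrow> \<phi> (1 * cesaro_mean x n) = 0" using zero[of 1] by auto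
  have "ces_modular \<phi> (\<lambda>i. 1 * x i) = (\<Sum>n<m. ennreal (\<phi> (cesaro_mean x n)))"
    unfolding ces_modular_def using m by (subst suminf_finite[of "{..<m}"]) auto
  also have "\<dots> < \<infinity>" by simp
  finally have "x \<in> ces_space \<phi>"
    unfolding ces_space_def by (intro CollectI exI[of _ 1]) auto
  moreover have "\<exists>m. (\<Sum>n. ennreal (\<phi> (k * cesaro_mean x (m + n)))) < \<infinity>" if k: "k > 0" for k
  proof -
    obtain m where "\<And>n. n \<ge> m \<Longrightarrow> \<phi> (k * cesaro_mean x n) = 0" using zero[OF k] by auto
    then have "(\<Sum>n. ennreal (\<phi> (k * cesaro_mean x (m + n)))) = 0" by simp
    then show ?thesis by (intro exI[of _ m]) simp
  qed
  ultimately show ?thesis by (simp add: ces_A_def)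
qed

lemma ces_A_not_strictly_monotone:
  assumes phi: "orlicz_function \<phi>" and u: "u > 0" "\<phi> u = 0"
  shows "\<not> strictly_monotone_space (ces_A \<phi>) (ces_norm \<phi>)"
proof -
  obtain K where K: "K > 0" "\<And>v. K \<le> v \<Longrightarrow> 1 < \<phi> v" using orlicz_gt_one[OF phi] by blast
  \<comment> \<open>This makes \<open>K * (2 / p) < u\<close>: means with numerator at most 2 from
    index \<open>p\<close> on, divided by any \<open>c \<ge> 1 / K\<close>, stay where \<phi>
    vanishes.\<close>
  obtain p where p: "real p > 2 * K / u" using reals_Archimedean2 by blast
  then have p0: "p > 0" using K u 
    by (metis divide_pos_pos mult_pos_pos of_nat_0_less_iff order_less_trans zero_less_numeral)
  define x :: "nat \<Rightarrow> real" where "x i = of_bool (i = 0)" for i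
  define y :: "nat \<Rightarrow> real" where "y i = of_bool (i = 0) + of_bool (i = p)" for i
  have cx: "cesaro_mean x n = 1 / real (Suc n)" for n
    by (simp add: cesaro_mean_def x_def of_bool_def)
  have "(\<Sum>j\<le>n. \<bar>y j\<bar>) = 1 + of_bool (p \<le> n)" for n
    by (simp add: y_def of_bool_def sum.distrib)
  then have cy: "cesaro_mean y n = (1 + of_bool (p \<le> n)) / real (Suc n)" for n
    by (simp add: cesaro_mean_def)
  have lim: "(\<lambda>n. c / real (Suc n)) \<longlonglongrightarrow> 0" for c
    using LIMSEQ_Suc[OF lim_const_over_n[of c]] by simp
  have "cesaro_mean x \<longlonglongrightarrow> 0"
    using lim[of 1] unfolding cx[abs_def, symmetric] .
  moreover have "cesaro_mean y \<longlonglongrightarrow> 0"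
    by (rule tendsto_sandwich[OF _ _ tendsto_const lim[of 2]])
      (auto simp: cesaro_mean_nonneg cy intro!: always_eventually divide_right_mono)
  ultimately have mem: "x \<in> ces_A \<phi>" "y \<in> ces_A \<phi>"
    by (auto intro: ces_A_memI[OF phi u])
  \<comment> \<open>Both \<open>x\<close> and \<open>y\<close> have first mean 1, so for
    \<open>c < 1 / K\<close> the first term alone exceeds 1 and \<open>c\<close> is admissible for
    neither.\<close>
  have big: "\<not> ces_modular \<phi> (\<lambda>i. z i / c) \<le> 1"
    if z: "cesaro_mean z 0 = 1" and c: "0 < c" "c < 1 / K" for z c
  proof -
    have "K \<le> 1 / c" using c K by (simp add: field_simps)
    then have "1 < ennreal (\<phi> (1 / c * cesaro_mean z 0))" using K z
      by (simp add: ennreal_1[symmetric] ennreal_less_iff del: ennreal_1)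
    also have "\<dots> = (\<Sum>n\<in>{0}. ennreal (\<phi> (1 / c * cesaro_mean z n)))" by simp
    also have "\<dots> \<le> ces_modular \<phi> (\<lambda>i. z i / c)"
      unfolding ces_modular_def cesaro_mean_divide[OF c(1)] by (intro sum_le_suminf) auto
    finally show ?thesis by simp
  qed
  \<comment> \<open>Before \<open>p\<close> the means coincide; from \<open>p\<close> on both terms
    are zero. With \<open>big\<close>, the two infima range over the same set.\<close>
  have same: "ces_modular \<phi> (\<lambda>i. x i / c) = ces_modular \<phi> (\<lambda>i. y i / c)" if c: "1 / K \<le> c" for c
  proof -
    have c0: "c > 0" using c K by (meson divide_pos_pos less_le_trans zero_less_one)
    have "\<phi> (1 / c * cesaro_mean x n) = \<phi> (1 / c * cesaro_mean y n)" for n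
    proof (cases "p \<le> n")
      case True
      \<comment> \<open>Here \<open>a\<close> is the numerator of the mean: 1 for \<open>x\<close>
        and 2 for \<open>y\<close>.\<close>
      have "\<phi> (1 / c * (a / real (Suc n))) = 0" if a: "0 \<le> a" "a \<le> 2" for a
      proof -
        have "1 / c * (a / real (Suc n)) \<le> K * (2 / real p)"
          using c c0 K p0 a True by (intro mult_mono frac_le) (auto simp: field_simps)
        also have "\<dots> \<le> u" using p p0 u by (simp add: field_simps)
        finally have "\<phi> (1 / c * (a / real (Suc n))) \<le> \<phi> u"
          using c0 a by (intro orlicz_mono[OF phi]) auto
        then show ?thesis using u orlicz_nonneg[OF phi] by (simp add: order_antisym)
      qed
      from this[of 1] this[of 2] show ?thesis using True by (simp add: cx cy)
    qed (simp add: cx cy)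
    then show ?thesis unfolding ces_modular_def cesaro_mean_divide[OF c0] by simp
  qed
  have "0 < c \<and> ces_modular \<phi> (\<lambda>i. x i / c) \<le> 1 \<longleftrightarrow> 0 < c \<and> ces_modular \<phi> (\<lambda>i. y i / c) \<le> 1" for c
    using big[of x c] big[of y c] same[of c] p0 by (cases "c < 1 / K") (auto simp: cx cy)
  then have "ces_norm \<phi> x = ces_norm \<phi> y" unfolding ces_norm_def by simp
  moreover have "x \<noteq> y" using p0 by (auto simp: fun_eq_iff x_def y_def)
  moreover have "\<forall>i. 0 \<le> x i \<and> x i \<le> y i" by (simp add: x_def y_def)
  ultimately show ?thesis using mem unfolding strictly_monotone_space_def by (metis less_irrefl)
qed

theorem theorem2p5:
  fixes \<phi> :: "real \<Rightarrow> real"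
  assumes "orlicz_function \<phi>"
    and "ces_space \<phi> \<noteq> {\<lambda>i. 0}"
  shows "strictly_monotone_space (ces_A \<phi>) (ces_norm \<phi>) \<longleftrightarrow> (\<forall>u. \<phi> u = 0 \<longrightarrow> u = 0)"
proof
  assume mono: "strictly_monotone_space (ces_A \<phi>) (ces_norm \<phi>)"
  show "\<forall>u. \<phi> u = 0 \<longrightarrow> u = 0"
  proof (intro allI impI, rule ccontr)
    fix u assume "\<phi> u = 0" "u \<noteq> 0"
    \<comment> \<open>Evenness moves the zero to the positive half line.\<close>
    then have "\<bar>u\<bar> > 0" "\<phi> \<bar>u\<bar> = 0"
      using assms(1) by (auto simp: orlicz_function_def abs_if)
    then show False using ces_A_not_strictly_monotone assms(1) mono by blast
  qed
qed (use ces_A_strictly_monotone assms(1) in blast)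

end
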